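(* Let $p\in\mathbb{N}$ and let $\mathbf{S}:\mathcal{D}(\mathbb{R}^p)\to\mathbb{R}^{p\times p}_{+}$ be a (standardized) scatter functional that is normal continuous, self-contained and full affine equivariant. Then $\mathbf{S}=\mathrm{Cov}$, i.e. $\mathbf{S}(\mathbf{x})=\mathrm{Cov}(\mathbf{x})$ for every $\mathbf{x}\in\mathcal{D}(\mathbb{R}^p)$.
   Context: Let $(\Omega,\mathcal{F},\mathbb{P})$ be a probability space, let $\mathbb{N}=\{1,2,\ldots\}$, and let $\mathbb{R}^{k\times k}_{+}$ and $\mathbb{R}^{k\times k}_{++}$ be the sets of symmetric positive semidefinite and symmetric positive-definite $k\times k$ real matrices, respectively. $\mathcal{D}(\mathbb{R})$ is a class of square-integrable random variables $\Omega\to\mathbb{R}$ containing a standard normal random variable, and $\mathcal{D}(\mathbb{R}^k)=\mathcal{D}(\mathbb{R})\times\cdots\times\mathcal{D}(\mathbb{R})$ ($k$ factors), viewed as a class of random vectors. It is assumed that $\mathbf{A}\mathbf{x}+\mathbf{b}\in\mathcal{D}(\mathbb{R}^k)$ for all $k,\ell\in\mathbb{N}$, $\mathbf{x}\in\mathcal{D}(\mathbb{R}^\ell)$, $\mathbf{A}\in\mathbb{R}^{k\times\ell}$ and $\mathbf{b}\in\mathbb{R}^k$. The class is also rich enough in the following sense: for all $k,\ell\in\mathbb{N}$, $\mathbf{x}\in\mathcal{D}(\mathbb{R}^k)$ and $\mathbf{y}\in\mathcal{D}(\mathbb{R}^\ell)$ there is $\mathbf{y}'\in\mathcal{D}(\mathbb{R}^\ell)$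 independent of $\mathbf{x}$ and with the same distribution as $\mathbf{y}$. A (standardized) scatter functional is a map $\mathbf{S}:\mathcal{D}(\mathbb{R}^p)\to\mathbb{R}^{p\times p}_{+}$ such that $\mathbf{S}(\mathbf{A}\mathbf{x}+\mathbf{b})=\mathbf{A}\mathbf{S}(\mathbf{x})\mathbf{A}^\top$ for all $\mathbf{x}\in\mathcal{D}(\mathbb{R}^p)$, invertible $\mathbf{A}\in\mathbb{R}^{p\times p}$ and $\mathbf{b}\in\mathbb{R}^p$, and $\mathbf{S}(\mathbf{z})=\mathbf{I}_p$ whenever $\mathbf{z}\in\mathcal{D}(\mathbb{R}^p)$ has distribution $\mathcal{N}(\mathbf{0},\mathbf{I}_p)$. (In the setting of full affine equivariance scatter functionals are allowed to take singular values.) $\mathbf{S}$ is full affine equivariant if there exists a family of functionals $\mathbb{S}=\{\mathbf{S}_k:\mathcal{D}(\mathbb{R}^k)\to\mathbb{R}^{k\times k}_{+}\mid k\in\mathbb{N}\}$ such that (i) $\mathbf{S}(\mathbf{x})=\mathbf{S}_p(\mathbf{x})$ for all $\mathbf{x}\in\mathcal{D}(\mathbb{R}^p)$; (ii) $\mathbf{S}_k(\mathbf{A}\mathbf{x}+\mathbf{b})=\mathbf{A}\mathbf{S}_\ell(\mathbf{x})\mathbf{A}^\top$ for all $k,\ell\in\mathbb{N}$, $\mathbf{x}\in\mathcal{D}(\mathbb{R}^\ell)$, $\mathbf{A}\in\mathbb{R}^{k\times\ell}$ and $\mathbf{b}\in\mathbb{R}^k$. $\mathbf{S}$ is normal continuous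 if for every $\boldsymbol{\Sigma}\in\mathbb{R}^{p\times p}_{++}$ and every sequence of zero-mean random vectors $\mathbf{x}_n\in\mathcal{D}(\mathbb{R}^p)$ converging in distribution to $\mathcal{N}(\mathbf{0},\boldsymbol{\Sigma})$, one has $\mathbf{S}(\mathbf{x}_n)\to\boldsymbol{\Sigma}$ (in some, equivalently any, matrix norm). $\mathbf{S}$ is self-contained if $\mathbf{S}(\mathbf{x}_1)=\mathbf{S}(\mathbf{x}_2)$ whenever $\mathbf{x}_1,\mathbf{x}_2\in\mathcal{D}(\mathbb{R}^p)$ are identically distributed. *)

theory Defs
  imports "HOL-Probability.Probability" "Jordan_Normal_Form.Gauss_Jordan_Elimination"
    "Jordan_Normal_Form.Determinant"
begin

no_notation inner (infix \<open>\<bullet>\<close> 70)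
no_notation vec_nth (infixl \<open>$\<close> 90)
hide_type (open) Finite_Cartesian_Product.vec
hide_const (open) Determinants.det Finite_Cartesian_Product.vec

definition sym_psd :: "nat \<Rightarrow> real mat set" where
  "sym_psd k = {A \<in> carrier_mat k k. transpose_mat A = A \<and>
     (\<forall>v\<in>carrier_vec k. v \<bullet> (A *\<^sub>v v) \<ge> 0)}"

definition sym_pd :: "nat \<Rightarrow> real mat set" where
  "sym_pd k = {A \<in> carrier_mat k k. transpose_mat A = A \<and>
     (\<forall>v\<in>carrier_vec k. v \<noteq> 0\<^sub>v k \<longrightarrow> v \<bullet> (A *\<^sub>v v) > 0)}"

definition frobenius_norm :: "real mat \<Rightarrow> real" where
  "frobenius_norm A = sqrt (\<Sum>i<dim_row A. \<Sum>j<dim_col A. (A $$ (i, j))\<^sup>2)"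

text \<open>
  Since \<^typ>\<open>real vec\<close> carries neither a sigma-algebra nor a topology, vectors of dimension
  \<open>k\<close> are transported to functions on the index set \<open>{..<k}\<close>; there the product
  sigma-algebra and the product topology are those of Euclidean \<open>k\<close>-space.
\<close>

definition borel_pow :: "nat \<Rightarrow> (nat \<Rightarrow> real) measure" where
  "borel_pow k = Pi\<^sub>M {..<k} (\<lambda>_. borel)"

definition coords :: "nat \<Rightarrow> real vec \<Rightarrow> nat \<Rightarrow> real" where
  "coords k v = (\<lambda>i\<in>{..<k}. v $ i)"

definition vec_law :: "'a measure \<Rightarrow> nat \<Rightarrow> ('a \<Rightarrow> real vec) \<Rightarrow> (nat \<Rightarrow> real) measure" where
  "vec_law M k x = distr M (borel_pow k) (\<lambda>\<omega>. coords k (x \<omega>))"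

text \<open>The centred normal law, by its Lebesgue density, for positive definite \<open>\<Sigma>\<close>.\<close>

definition normal_law :: "nat \<Rightarrow> real mat \<Rightarrow> (nat \<Rightarrow> real) measure" where
  "normal_law k \<Sigma> = density (Pi\<^sub>M {..<k} (\<lambda>_. lborel))
     (\<lambda>u. ennreal (exp (- (vec k u \<bullet> (the (mat_inverse \<Sigma>) *\<^sub>v vec k u)) / 2)
                   / sqrt ((2 * pi) ^ k * det \<Sigma>)))"

definition conv_in_law ::
  "nat \<Rightarrow> (nat \<Rightarrow> (nat \<Rightarrow> real) measure) \<Rightarrow> (nat \<Rightarrow> real) measure \<Rightarrow> bool" where
  "conv_in_law k \<mu> \<nu> \<longleftrightarrow>
     (\<forall>f. continuous_map (powertop_real {..<k}) euclideanreal f \<and>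
          bounded (f ` topspace (powertop_real {..<k})) \<longrightarrow>
          (\<lambda>n. integral\<^sup>L (\<mu> n) f) \<longlonglongrightarrow> integral\<^sup>L \<nu> f)"

definition rvecs :: "('a \<Rightarrow> real) set \<Rightarrow> nat \<Rightarrow> ('a \<Rightarrow> real vec) set" where
  "rvecs D k = {x. (\<forall>\<omega>. x \<omega> \<in> carrier_vec k) \<and> (\<forall>i<k. (\<lambda>\<omega>. x \<omega> $ i) \<in> D)}"

definition cov_mat :: "'a measure \<Rightarrow> nat \<Rightarrow> ('a \<Rightarrow> real vec) \<Rightarrow> real mat" where
  "cov_mat M k x = mat k k (\<lambda>(i, j).
     \<integral>\<omega>. (x \<omega> $ i - (\<integral>\<omega>'. x \<omega>' $ i \<partial>M)) * (x \<omega> $ j - (\<integral>\<omega>'. x \<omega>' $ j \<partial>M)) \<partial>M)"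

definition rv_class :: "'a measure \<Rightarrow> ('a \<Rightarrow> real) set \<Rightarrow> bool" where
  "rv_class M D \<longleftrightarrow>
     prob_space M \<and>
     (\<forall>x\<in>D. x \<in> borel_measurable M \<and> integrable M (\<lambda>\<omega>. (x \<omega>)\<^sup>2)) \<and>
     (\<exists>z\<in>D. distributed M lborel z std_normal_density) \<and>
     (\<forall>k\<ge>1. \<forall>l\<ge>1. \<forall>x\<in>rvecs D l. \<forall>A\<in>carrier_mat k l. \<forall>b\<in>carrier_vec k.
        (\<lambda>\<omega>. A *\<^sub>v x \<omega> + b) \<in> rvecs D k) \<and>
     (\<forall>k\<ge>1. \<forall>l\<ge>1. \<forall>x\<in>rvecs D k. \<forall>y\<in>rvecs D l. \<exists>y'\<in>rvecs D l.
        prob_space.indep_var M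
          (borel_pow k) (\<lambda>\<omega>. coords k (x \<omega>)) (borel_pow l) (\<lambda>\<omega>. coords l (y' \<omega>)) \<and>
        vec_law M l y' = vec_law M l y)"

definition scatter_functional ::
  "'a measure \<Rightarrow> ('a \<Rightarrow> real) set \<Rightarrow> nat \<Rightarrow> (('a \<Rightarrow> real vec) \<Rightarrow> real mat) \<Rightarrow> bool" where
  "scatter_functional M D p S \<longleftrightarrow>
     (\<forall>x\<in>rvecs D p. S x \<in> sym_psd p) \<and>
     (\<forall>x\<in>rvecs D p. \<forall>A\<in>carrier_mat p p. \<forall>b\<in>carrier_vec p. invertible_mat A \<longrightarrow>
        S (\<lambda>\<omega>. A *\<^sub>v x \<omega> + b) = A * S x * transpose_mat A) \<and>
     (\<forall>z\<in>rvecs D p. vec_law M p z = normal_law p (1\<^sub>m p) \<longrightarrow> S z = 1\<^sub>m p)"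

definition full_affine_equivariant ::
  "('a \<Rightarrow> real) set \<Rightarrow> nat \<Rightarrow> (('a \<Rightarrow> real vec) \<Rightarrow> real mat) \<Rightarrow> bool" where
  "full_affine_equivariant D p S \<longleftrightarrow>
     (\<exists>F :: nat \<Rightarrow> ('a \<Rightarrow> real vec) \<Rightarrow> real mat.
        (\<forall>k\<ge>1. \<forall>x\<in>rvecs D k. F k x \<in> sym_psd k) \<and>
        (\<forall>x\<in>rvecs D p. S x = F p x) \<and>
        (\<forall>k\<ge>1. \<forall>l\<ge>1. \<forall>x\<in>rvecs D l. \<forall>A\<in>carrier_mat k l. \<forall>b\<in>carrier_vec k.
           F k (\<lambda>\<omega>. A *\<^sub>v x \<omega> + b) = A * F l x * transpose_mat A))"

definition normal_continuous ::
  "'a measure \<Rightarrow> ('a \<Rightarrow> real) set \<Rightarrow> nat \<Rightarrow> (('a \<Rightarrow> real vec) \<Rightarrow> real mat) \<Rightarrow> bool" where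
  "normal_continuous M D p S \<longleftrightarrow>
     (\<forall>\<Sigma>\<in>sym_pd p. \<forall>x :: nat \<Rightarrow> 'a \<Rightarrow> real vec.
        (\<forall>n. x n \<in> rvecs D p) \<and>
        (\<forall>n. \<forall>i<p. (\<integral>\<omega>. x n \<omega> $ i \<partial>M) = 0) \<and>
        conv_in_law p (\<lambda>n. vec_law M p (x n)) (normal_law p \<Sigma>) \<longrightarrow>
        (\<lambda>n. frobenius_norm (S (x n) - \<Sigma>)) \<longlonglongrightarrow> 0)"

definition self_contained ::
  "'a measure \<Rightarrow> ('a \<Rightarrow> real) set \<Rightarrow> nat \<Rightarrow> (('a \<Rightarrow> real vec) \<Rightarrow> real mat) \<Rightarrow> bool" where
  "self_contained M D p S \<longleftrightarrow>
     (\<forall>x1\<in>rvecs D p. \<forall>x2\<in>rvecs D p. vec_law M p x1 = vec_law M p x2 \<longrightarrow> S x1 = S x2)"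

end

theory Submission
  imports Defs
begin

text \<open>
  Let \<open>F\<close> be a family that witnesses full affine equivariance. Applied to the row matrix of a
  vector \<open>a\<close>, equivariance says that the quadratic form of \<open>F l x\<close> at \<open>a\<close> is \<open>F 1\<close> of the scalar
  \<open>a \<bullet> x\<close>. So everything is encoded in one functional \<open>scale_sq\<close> on scalar random variables,
  and since the matrices are symmetric, they are recovered from it by polarization. As the
  covariance is recovered from the variance in the same way, it suffices to show that
  \<open>scale_sq\<close> is the variance.

  \<open>scale_sq\<close> inherits two properties from the functional in dimension \<open>p\<close>. It depends on the law
  only: embed \<open>y\<close> as \<open>(y, 0, \<dots>, 0)\<close>. And \<open>scale_sq (T n)\<close> tends to 1 if the \<open>T n\<close> are centred and
  converge in law to the standard normal: complete \<open>T n\<close> to a random vector by \<open>p - 1\<close>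
  independent standard normals, which makes the vectors converge to the standard normal law in
  dimension \<open>p\<close>.

  Now let \<open>y\<close> be centred with variance 1 and take \<open>n\<close> independent copies of it. Let \<open>c\<close> be
  \<open>scale_sq y\<close>. The matrix that \<open>F n\<close> gives to the vector of copies has the diagonal entries \<open>c\<close>,
  and all its off-diagonal entries are equal to one number \<open>d\<close>, which by polarization depends
  only on the law of the sum of two copies and hence not on \<open>n\<close>. The value of \<open>scale_sq\<close> at the
  normalized sum of the copies is therefore \<open>c + (n - 1) * d\<close>. By the central limit theorem
  these numbers tend to 1 as \<open>n\<close> grows, so that \<open>d = 0\<close> and \<open>c = 1\<close> (\<open>scale_sq_standardized\<close>).
  So it is the growth in \<open>n\<close> that forces \<open>F\<close> to see no correlation between independent copies.
  Scaling and translation give the general case.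
\<close>

section \<open>Normal laws, product laws and convergence in law\<close>

lemma abs_entry_le_frobenius_norm:
  assumes "i < dim_row A" "j < dim_col A"
  shows "\<bar>A $$ (i, j)\<bar> \<le> frobenius_norm A"
proof -
  have "(A $$ (i, j))\<^sup>2 \<le> (\<Sum>j<dim_col A. (A $$ (i, j))\<^sup>2)"
    using assms by (intro member_le_sum) auto
  also have "\<dots> \<le> (\<Sum>i<dim_row A. \<Sum>j<dim_col A. (A $$ (i, j))\<^sup>2)"
    using assms by (intro member_le_sum[where f = "\<lambda>i. \<Sum>j<dim_col A. (A $$ (i, j))\<^sup>2"]) (auto intro: sum_nonneg)
  finally show ?thesis
    unfolding frobenius_norm_def by (simp add: real_le_rsqrt)
qed

lemma one_mat_sym_pd: "1\<^sub>m k \<in> sym_pd k"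
  unfolding sym_pd_def
proof (intro CollectI conjI ballI impI)
  fix v :: "real vec" assume v: "v \<in> carrier_vec k" "v \<noteq> 0\<^sub>v k"
  then obtain i where "i < k" "v $ i \<noteq> 0" by (metis carrier_vecD eq_vecI index_zero_vec)
  then have "0 < (\<Sum>i<k. (v $ i)\<^sup>2)" by (intro sum_pos2[of _ i]) auto
  then show "v \<bullet> (1\<^sub>m k *\<^sub>v v) > 0"
    using v by (simp add: scalar_prod_def power2_eq_square lessThan_atLeast0)
qed auto

lemma std_normal_real_distribution: "real_distribution std_normal_distribution"
  by (simp add: real_distribution_def real_distribution_axioms_def prob_space_normal_density)

lemma mat_inverse_one: "mat_inverse (1\<^sub>m k :: real mat) = Some (1\<^sub>m k)"
proof -
  have "1\<^sub>m k \<in> Units (ring_mat TYPE(real) k ())"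
    unfolding Units_def by (auto simp: ring_mat_def intro!: exI[of _ "1\<^sub>m k"] bexI[of _ "1\<^sub>m k"])
  then obtain B where B: "mat_inverse (1\<^sub>m k :: real mat) = Some B"
    using mat_inverse(1)[of "1\<^sub>m k :: real mat" k "()"] by (cases "mat_inverse (1\<^sub>m k :: real mat)") auto
  from mat_inverse(2)[OF one_carrier_mat this] show ?thesis using B by auto
qed

text \<open>
  As a product, the standard normal law can be approached by replacing one of its factors, which
  reduces convergence to it to convergence on the line.
\<close>

lemma normal_law_one:
  "normal_law k (1\<^sub>m k) = Pi\<^sub>M {..<k} (\<lambda>_. std_normal_distribution)"
proof -
  interpret product_sigma_finite "\<lambda>_::nat. std_normal_distribution"
    by (intro product_sigma_finite.intro prob_space_imp_sigma_finite prob_space_normal_density) simp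
  interpret L: product_sigma_finite "\<lambda>_::nat. lborel :: real measure" ..
  have dens: "ennreal (exp (- (vec k u \<bullet> (the (mat_inverse (1\<^sub>m k)) *\<^sub>v vec k u)) / 2)
        / sqrt ((2 * pi) ^ k * Determinant.det (1\<^sub>m k))) = (\<Prod>i<k. ennreal (std_normal_density (u i)))" for u
  proof -
    have "vec k u \<bullet> (the (mat_inverse (1\<^sub>m k)) *\<^sub>v vec k u) = (\<Sum>i<k. (u i)\<^sup>2)"
      by (simp add: mat_inverse_one scalar_prod_def power2_eq_square lessThan_atLeast0)
    moreover have "(\<Prod>i<k. std_normal_density (u i)) = exp (- (\<Sum>i<k. (u i)\<^sup>2) / 2) / sqrt ((2 * pi) ^ k)"
      by (simp add: std_normal_density_def prod.distrib prod_dividef real_sqrt_power exp_sum[symmetric]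
          sum_negf[symmetric] sum_divide_distrib prod_constant real_sqrt_mult power_divide power_mult_distrib)
    ultimately show ?thesis by (simp add: prod_ennreal)
  qed
  show ?thesis
    unfolding normal_law_def dens
  proof (rule PiM_eqI)
    show "sets (density (Pi\<^sub>M {..<k} (\<lambda>_. lborel)) (\<lambda>u. \<Prod>i<k. ennreal (std_normal_density (u i)))) =
      sets (Pi\<^sub>M {..<k} (\<lambda>_. std_normal_distribution))"
      by (auto intro!: sets_PiM_cong)
    fix A :: "nat \<Rightarrow> real set"
    assume A: "\<And>i. i \<in> {..<k} \<Longrightarrow> A i \<in> sets std_normal_distribution"
    then have A': "\<And>i. i < k \<Longrightarrow> A i \<in> sets borel" by simp
    have "Pi\<^sub>E {..<k} A \<in> sets (Pi\<^sub>M {..<k} (\<lambda>_. lborel))"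
      using A' by (intro sets_PiM_I_finite) auto
    then have "emeasure (density (Pi\<^sub>M {..<k} (\<lambda>_. lborel)) (\<lambda>u. \<Prod>i<k. ennreal (std_normal_density (u i)))) (Pi\<^sub>E {..<k} A)
      = (\<integral>\<^sup>+u. (\<Prod>i<k. ennreal (std_normal_density (u i))) * indicator (Pi\<^sub>E {..<k} A) u \<partial>Pi\<^sub>M {..<k} (\<lambda>_. lborel))"
      by (intro emeasure_density) auto
    also have "\<dots> = (\<integral>\<^sup>+u. (\<Prod>i<k. ennreal (std_normal_density (u i)) * indicator (A i) (u i)) \<partial>Pi\<^sub>M {..<k} (\<lambda>_. lborel))"
    proof (rule nn_integral_cong)
      fix u assume "u \<in> space (Pi\<^sub>M {..<k} (\<lambda>_. lborel :: real measure))"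
      then have "u \<in> extensional {..<k}" by (auto simp: space_PiM PiE_def)
      then have "indicator (Pi\<^sub>E {..<k} A) u = (\<Prod>i<k. indicator (A i) (u i) :: ennreal)"
        by (auto simp: indicator_def PiE_def prod_zero_iff Pi_iff)
      then show "(\<Prod>i<k. ennreal (std_normal_density (u i))) * indicator (Pi\<^sub>E {..<k} A) u
        = (\<Prod>i<k. ennreal (std_normal_density (u i)) * indicator (A i) (u i))"
        by (simp add: prod.distrib)
    qed
    also have "\<dots> = (\<Prod>i<k. \<integral>\<^sup>+t. ennreal (std_normal_density t) * indicator (A i) t \<partial>lborel)"
      using A' by (intro L.product_nn_integral_prod) auto
    also have "\<dots> = (\<Prod>i<k. emeasure std_normal_distribution (A i))"
      using A' by (intro prod.cong refl) (auto simp: emeasure_density)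
    finally show "emeasure (density (Pi\<^sub>M {..<k} (\<lambda>_. lborel)) (\<lambda>u. \<Prod>i<k. ennreal (std_normal_density (u i)))) (Pi\<^sub>E {..<k} A)
      = (\<Prod>i<k. emeasure std_normal_distribution (A i))" .
  qed simp
qed

text \<open>
  The Borel sets of a countable power of the reals are those of its product sigma-algebra; a
  finite power is reduced to this case by extending a function of \<open>k\<close> coordinates to all
  sequences.
\<close>

lemma measurable_of_continuous_map:
  fixes k :: nat
  assumes "continuous_map (powertop_real {..<k}) euclideanreal f"
  shows "f \<in> borel_measurable (Pi\<^sub>M {..<k} (\<lambda>_. borel :: real measure))"
proof -
  have "continuous_map (product_topology (\<lambda>_. euclideanreal) UNIV) (powertop_real {..<k}) (\<lambda>u. restrict u {..<k})"
    by (auto simp: continuous_map_componentwise intro: continuous_map_product_projection)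
  then have "continuous_on UNIV (\<lambda>u. f (restrict u {..<k}))"
    using continuous_map_compose[OF _ assms, of euclidean "\<lambda>u. restrict u {..<k}"]
    by (simp add: o_def euclidean_product_topology)
  then have "(\<lambda>u. f (restrict u {..<k})) \<in> borel_measurable borel"
    by (rule borel_measurable_continuous_onI)
  moreover have "(\<lambda>u. u) \<in> Pi\<^sub>M {..<k} (\<lambda>_. borel :: real measure) \<rightarrow>\<^sub>M (borel :: (nat \<Rightarrow> real) measure)"
  proof -
    have "(\<lambda>u. u i) \<in> borel_measurable (Pi\<^sub>M {..<k} (\<lambda>_. borel :: real measure))" for i
    proof (cases "i < k")
      case False
      then have "(\<lambda>u. u i) \<in> borel_measurable (Pi\<^sub>M {..<k} (\<lambda>_. borel :: real measure))
        \<longleftrightarrow> (\<lambda>u. undefined :: real) \<in> borel_measurable (Pi\<^sub>M {..<k} (\<lambda>_. borel :: real measure))"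
        by (intro measurable_cong) (auto simp: space_PiM PiE_def extensional_def)
      then show ?thesis by simp
    qed (simp add: measurable_component_singleton)
    then have "(\<lambda>u i. u i) \<in> Pi\<^sub>M {..<k} (\<lambda>_. borel :: real measure) \<rightarrow>\<^sub>M Pi\<^sub>M UNIV (\<lambda>_. borel)"
      by (intro measurable_PiM_single') auto
    then show ?thesis
      by (simp add: measurable_cong_sets[OF refl sets_PiM_equal_borel])
  qed
  ultimately have "(\<lambda>u. f (restrict u {..<k})) \<in> borel_measurable (Pi\<^sub>M {..<k} (\<lambda>_. borel :: real measure))"
    using measurable_compose by blast
  then show ?thesis
    by (rule measurable_cong[THEN iffD1, rotated]) (auto simp: space_PiM restrict_PiE)
qed

text \<open>
  Integrating a bounded continuous function over the other factors leaves, by dominated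
  convergence, a bounded continuous function of the first coordinate. Convergence in law of the
  first factor is then enough.
\<close>

lemma conv_in_law_replace_first_factor:
  fixes \<mu> :: "nat \<Rightarrow> real measure" and \<nu> :: "real measure" and N :: "nat \<Rightarrow> real measure"
  assumes k: "k \<ge> 1" and \<mu>: "\<And>n. real_distribution (\<mu> n)" and \<nu>: "real_distribution \<nu>"
    and N: "\<And>i. real_distribution (N i)" and conv: "weak_conv_m \<mu> \<nu>"
  shows "conv_in_law k (\<lambda>n. Pi\<^sub>M {..<k} (\<lambda>i. if i = 0 then \<mu> n else N i))
    (Pi\<^sub>M {..<k} (\<lambda>i. if i = 0 then \<nu> else N i))"
  unfolding conv_in_law_def
proof (intro allI impI, elim conjE)
  fix f assume cont: "continuous_map (powertop_real {..<k}) euclideanreal f"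
    and "bounded (f ` topspace (powertop_real {..<k}))"
  then obtain B where B: "\<And>u. u \<in> extensional {..<k} \<Longrightarrow> \<bar>f u\<bar> \<le> B"
    by (auto simp: bounded_iff PiE_UNIV_domain PiE_def)
  define Q where "Q = Pi\<^sub>M {1..<k} N"
  define g where "g t = (\<integral>u. f (u(0 := t)) \<partial>Q)" for t
  have ins: "{..<k} = insert 0 {1..<k}" using k by auto
  have fm: "f \<in> borel_measurable (Pi\<^sub>M {..<k} (\<lambda>_. borel :: real measure))"
    using cont by (rule measurable_of_continuous_map)
  interpret Q: prob_space Q
    unfolding Q_def using N by (intro prob_space_PiM) (auto simp: real_distribution_def)
  have Qs: "sets Q = sets (Pi\<^sub>M {1..<k} (\<lambda>_. borel :: real measure))"
    unfolding Q_def using real_distribution.events_eq_borel[OF N] by (intro sets_PiM_cong) auto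
  have Qe: "u(0 := t) \<in> extensional {..<k}" if "u \<in> space Q" for u t
    using that unfolding Q_def space_PiM ins PiE_def by (auto simp: extensional_def)
  have fu: "(\<lambda>u. f (u(0 := t))) \<in> borel_measurable Q" for t
  proof -
    have "(\<lambda>u. u(0 := t)) \<in> Pi\<^sub>M {1..<k} (\<lambda>_. borel :: real measure) \<rightarrow>\<^sub>M Pi\<^sub>M {..<k} (\<lambda>_. borel)"
      unfolding ins by measurable
    from measurable_compose[OF this fm] show ?thesis
      unfolding measurable_cong_sets[OF Qs refl] .
  qed
  \<comment> \<open>sequential continuity, since dominated convergence is a statement about sequences\<close>
  have gcont: "isCont g t" for t
    unfolding continuous_at_sequentially o_def
  proof safe
    fix s assume s: "s \<longlonglongrightarrow> t"
    show "(\<lambda>n. g (s n)) \<longlonglongrightarrow> g t"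
      unfolding g_def
    proof (rule integral_dominated_convergence[where w = "\<lambda>_. B"])
      show "AE u in Q. (\<lambda>n. f (u(0 := s n))) \<longlonglongrightarrow> f (u(0 := t))"
      proof (rule AE_I2)
        fix u assume u: "u \<in> space Q"
        have "limitin (powertop_real {..<k}) (\<lambda>n. u(0 := s n)) (u(0 := t)) sequentially"
          using Qe[OF u] s by (auto simp: limitin_componentwise PiE_def)
        from continuous_map_limit[OF cont this]
        show "(\<lambda>n. f (u(0 := s n))) \<longlonglongrightarrow> f (u(0 := t))" by (simp add: o_def)
      qed
    qed (use fu B Qe in auto)
  qed
  have gB: "norm (g t) \<le> B" for t
  proof -
    have "integrable Q (\<lambda>u. f (u(0 := t)))"
      using fu B Qe by (intro Q.integrable_const_bound[where B = B]) auto
    then have "(\<integral>u. norm (f (u(0 := t))) \<partial>Q) \<le> B"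
      using B Qe by (intro Q.integral_le_const) auto
    then show ?thesis unfolding g_def by (rule order_trans[OF integral_norm_bound])
  qed
  have fubini: "integral\<^sup>L (Pi\<^sub>M {..<k} (\<lambda>i. if i = 0 then \<rho> else N i)) f = integral\<^sup>L \<rho> g"
    if \<rho>: "real_distribution \<rho>" for \<rho>
  proof -
    interpret \<rho>: real_distribution \<rho> by fact
    let ?N = "\<lambda>i. if i = 0 then \<rho> else N i"
    have rd: "real_distribution (?N i)" for i using N \<rho> by auto
    have pr: "prob_space (?N i)" for i using rd[of i] unfolding real_distribution_def by blast
    have Q': "Pi\<^sub>M {1..<k} ?N = Q" unfolding Q_def by (rule PiM_cong) auto
    have s: "sets (Pi\<^sub>M {..<k} ?N) = sets (Pi\<^sub>M {..<k} (\<lambda>_. borel :: real measure))"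
      using real_distribution.events_eq_borel[OF rd] by (intro sets_PiM_cong) auto
    have fm': "f \<in> borel_measurable (Pi\<^sub>M (insert 0 {1..<k}) ?N)"
      using fm by (simp only: ins[symmetric] measurable_cong_sets[OF s refl])
    have um: "(\<lambda>(t, u). u(0 := t)) \<in> \<rho> \<Otimes>\<^sub>M Q \<rightarrow>\<^sub>M Pi\<^sub>M (insert 0 {1..<k}) ?N"
    proof -
      have "(\<lambda>(t, u). u(0 := t)) \<in> ?N 0 \<Otimes>\<^sub>M Pi\<^sub>M {1..<k} ?N \<rightarrow>\<^sub>M Pi\<^sub>M (insert 0 {1..<k}) ?N"
        by measurable
      then show ?thesis unfolding Q' by simp
    qed
    interpret R: pair_prob_space \<rho> Q ..
    have "Pi\<^sub>M {..<k} ?N = distr (\<rho> \<Otimes>\<^sub>M Q) (Pi\<^sub>M (insert 0 {1..<k}) ?N) (\<lambda>(t, u). u(0 := t))"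
      using distr_pair_PiM_eq_PiM[of "{1..<k}" ?N 0, OF pr pr] unfolding Q' ins by simp
    then have "integral\<^sup>L (Pi\<^sub>M {..<k} ?N) f = (\<integral>z. f ((\<lambda>(t, u). u(0 := t)) z) \<partial>(\<rho> \<Otimes>\<^sub>M Q))"
      using um fm' by (simp add: integral_distr)
    also have "\<dots> = (\<integral>t. (\<integral>u. f (u(0 := t)) \<partial>Q) \<partial>\<rho>)"
    proof -
      have "integrable (\<rho> \<Otimes>\<^sub>M Q) (\<lambda>z. f ((\<lambda>(t, u). u(0 := t)) z))"
        using B Qe
        by (intro R.P.integrable_const_bound[where B = B] measurable_compose[OF um fm'])
          (auto simp: space_pair_measure)
      from R.integral_fst'[OF this] show ?thesis by simp
    qed
    finally show ?thesis by (simp add: g_def[abs_def])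
  qed
  show "(\<lambda>n. integral\<^sup>L (Pi\<^sub>M {..<k} (\<lambda>i. if i = 0 then \<mu> n else N i)) f)
    \<longlonglongrightarrow> integral\<^sup>L (Pi\<^sub>M {..<k} (\<lambda>i. if i = 0 then \<nu> else N i)) f"
    unfolding fubini[OF \<mu>] fubini[OF \<nu>]
    by (rule weak_conv_imp_integral_bdd_continuous_conv[OF \<mu> \<nu> conv gcont gB])
qed

text \<open>
  Makes the off-diagonal entry of an independent sample independent of the indices and of the
  sample size.
\<close>

lemma distr_iid_pair_sum:
  fixes \<mu> :: "real measure" and i j n :: nat
  assumes \<mu>: "real_distribution \<mu>" and ij: "i < n" "j < n" "i \<noteq> j"
  shows "distr (Pi\<^sub>M {..<n} (\<lambda>_. \<mu>)) borel (\<lambda>u. u i + u j)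
    = distr (Pi\<^sub>M {..<2} (\<lambda>_. \<mu>)) borel (\<lambda>u. u 0 + u (1 :: nat))"
proof -
  let ?f = "\<lambda>k::nat. if k = 0 then i else j"
  have ps: "prob_space \<mu>" using \<mu> by (simp add: real_distribution_def)
  have m: "(\<lambda>u. u k) \<in> borel_measurable (Pi\<^sub>M {..<r} (\<lambda>_. \<mu>))" if "k < r" for k r :: nat
    using that by (subst measurable_cong_sets[OF refl real_distribution.events_eq_borel[OF \<mu>, symmetric]])
      (intro measurable_component_singleton, simp)
  have "distr (Pi\<^sub>M {..<2} (\<lambda>_. \<mu>)) borel (\<lambda>u. u 0 + u (1 :: nat))
    = distr (distr (Pi\<^sub>M {..<n} (\<lambda>_. \<mu>)) (Pi\<^sub>M {..<2} (\<lambda>_. \<mu>)) (\<lambda>u. \<lambda>k\<in>{..<2}. u (?f k)))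
        borel (\<lambda>u. u 0 + u (1 :: nat))"
    by (subst distr_PiM_reindex) (use ij ps in \<open>auto simp: inj_on_def less_2_cases_iff\<close>)
  also have "\<dots> = distr (Pi\<^sub>M {..<n} (\<lambda>_. \<mu>)) borel (\<lambda>u. u i + u j)"
  proof (subst distr_distr)
    show "(\<lambda>u. \<lambda>k\<in>{..<2}. u (?f k)) \<in> Pi\<^sub>M {..<n} (\<lambda>_. \<mu>) \<rightarrow>\<^sub>M Pi\<^sub>M {..<2} (\<lambda>_. \<mu>)"
      using ij by (intro measurable_restrict measurable_component_singleton) auto
    show "(\<lambda>u. u 0 + u (1 :: nat)) \<in> borel_measurable (Pi\<^sub>M {..<2} (\<lambda>_. \<mu>))"
      by (intro borel_measurable_add m) auto
  qed (simp add: o_def)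
  finally show ?thesis by simp
qed

text \<open>
  The central limit theorem speaks of one infinite sequence. This form refers to finite product
  laws only, so that for each \<open>n\<close> an unrelated sample of size \<open>n\<close> may realize it; the infinite
  sequence is found on an infinite product space and forgotten again.
\<close>

lemma iid_sums_weak_conv:
  fixes \<mu> :: "real measure"
  assumes \<mu>: "real_distribution \<mu>" and sq: "integrable \<mu> (\<lambda>t. t\<^sup>2)"
    and mean: "(\<integral>t. t \<partial>\<mu>) = 0" and var: "(\<integral>t. t\<^sup>2 \<partial>\<mu>) = 1"
  shows "weak_conv_m (\<lambda>n. distr (Pi\<^sub>M {..<n} (\<lambda>_. \<mu>)) borel (\<lambda>u. (\<Sum>i<n. u i) / sqrt (real n)))
    std_normal_distribution"
proof -
  interpret \<mu>: real_distribution \<mu> by fact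
  let ?N = "Pi\<^sub>M (UNIV :: nat set) (\<lambda>_. \<mu>)"
  interpret N: product_prob_space "\<lambda>_. \<mu>" "UNIV :: nat set" ..
  have comp: "distr ?N \<mu> (\<lambda>u. u i) = \<mu>" for i
    using N.PiM_component[of i] by simp
  have comp': "distr ?N borel (\<lambda>u. u i) = \<mu>" for i
    using comp[of i] by (metis distr_cong \<mu>.events_eq_borel)
  have m[measurable]: "(\<lambda>u. u i) \<in> borel_measurable ?N" for i
    by (subst measurable_cong_sets[OF refl \<mu>.events_eq_borel[symmetric]]) (rule measurable_component_singleton, simp)
  have int: "(\<integral>u. h (u i) \<partial>?N) = (\<integral>t. h t \<partial>\<mu>)" if "h \<in> borel_measurable borel" for h :: "real \<Rightarrow> real" and i
    using integral_distr[OF m that, of i] comp' by simp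
  have ind: "N.indep_vars (\<lambda>i. borel) (\<lambda>i u. u i) UNIV"
  proof (subst N.indep_vars_iff_distr_eq_PiM)
    show "distr ?N (Pi\<^sub>M UNIV (\<lambda>i. borel)) (\<lambda>u. \<lambda>i\<in>UNIV. u i) = Pi\<^sub>M UNIV (\<lambda>i. distr ?N borel (\<lambda>u. u i))"
      unfolding comp' by (subst distr_cong[OF refl _ refl, of _ ?N])
        (auto intro!: sets_PiM_cong simp: restrict_UNIV distr_id)
  qed auto
  have "weak_conv_m (\<lambda>n. distr ?N borel (\<lambda>u. (\<Sum>i<n. u i) / sqrt (real n * 1\<^sup>2))) std_normal_distribution"
  proof (rule N.central_limit_theorem_zero_mean[OF ind])
    show "integrable ?N (\<lambda>u. (u n)\<^sup>2)" for n
      using integrable_distr_eq[OF m, of "\<lambda>t. t\<^sup>2" n] comp' sq by simp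
    show e: "N.expectation (\<lambda>u. u n) = 0" for n using int[of "\<lambda>t. t" n] mean by simp
    show "N.variance (\<lambda>u. u n) = 1\<^sup>2" for n using int[of "\<lambda>t. t\<^sup>2" n] var e by simp
    show "distr ?N borel (\<lambda>u. u n) = \<mu>" for n by (rule comp')
  qed simp
  moreover have "distr ?N borel (\<lambda>u. (\<Sum>i<n. u i) / sqrt (real n * 1\<^sup>2))
    = distr (Pi\<^sub>M {..<n} (\<lambda>_. \<mu>)) borel (\<lambda>u. (\<Sum>i<n. u i) / sqrt (real n))" for n
  proof -
    have mm: "(\<lambda>u. u i) \<in> borel_measurable (Pi\<^sub>M {..<n} (\<lambda>_. \<mu>))" if "i < n" for i
      using that by (subst measurable_cong_sets[OF refl \<mu>.events_eq_borel[symmetric]]) (intro measurable_component_singleton, simp)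
    have "distr (distr ?N (Pi\<^sub>M {..<n} (\<lambda>_. \<mu>)) (\<lambda>u. restrict u {..<n})) borel (\<lambda>u. (\<Sum>i<n. u i) / sqrt (real n))
      = distr ?N borel ((\<lambda>u. (\<Sum>i<n. u i) / sqrt (real n)) \<circ> (\<lambda>u. restrict u {..<n}))"
      by (rule distr_distr) (auto intro!: borel_measurable_divide borel_measurable_sum mm measurable_restrict_subset)
    then show ?thesis
      by (simp add: N.distr_PiM_restrict_finite o_def)
  qed
  ultimately show ?thesis by simp
qed

section \<open>Independent copies in the class of random variables\<close>

locale square_integrable_class = prob_space M for M :: "'a measure" +
  fixes D :: "('a \<Rightarrow> real) set"
  assumes rv_class: "rv_class M D"
begin

lemma measurable_class: "y \<in> D \<Longrightarrow> y \<in> borel_measurable M"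
  using rv_class by (auto simp: rv_class_def)

lemma square_integrable_class: "y \<in> D \<Longrightarrow> integrable M (\<lambda>\<omega>. (y \<omega>)\<^sup>2)"
  using rv_class by (auto simp: rv_class_def)

lemma integrable_class: "y \<in> D \<Longrightarrow> integrable M y"
  using square_integrable_imp_integrable[of y] measurable_class square_integrable_class by auto

lemma real_distribution_law: "y \<in> D \<Longrightarrow> real_distribution (distr M borel y)"
  by (intro real_distribution_distr measurable_class)

lemma rvecs_component: "x \<in> rvecs D l \<Longrightarrow> i < l \<Longrightarrow> (\<lambda>\<omega>. x \<omega> $ i) \<in> D"
  by (auto simp: rvecs_def)

lemma rvecs_of_components: "(\<And>i. i < l \<Longrightarrow> Y i \<in> D) \<Longrightarrow> (\<lambda>\<omega>. vec l (\<lambda>i. Y i \<omega>)) \<in> rvecs D l"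
  by (auto simp: rvecs_def cong: conj_cong)

lemma affine_combination_in_class:
  assumes "x \<in> rvecs D l" "l \<ge> 1"
  shows "(\<lambda>\<omega>. (\<Sum>i<l. a i * x \<omega> $ i) + b) \<in> D"
proof -
  have x: "x \<omega> \<in> carrier_vec l" for \<omega> using assms by (auto simp: rvecs_def)
  let ?A = "mat 1 l (\<lambda>(_, i). a i)" and ?b = "vec 1 (\<lambda>_. b)"
  have "(\<lambda>\<omega>. ?A *\<^sub>v x \<omega> + ?b) \<in> rvecs D 1"
    using rv_class assms unfolding rv_class_def by (metis le_refl mat_carrier vec_carrier)
  from rvecs_component[OF this, of 0] show ?thesis
    using x by (simp add: scalar_prod_def carrier_vecD[OF x] lessThan_atLeast0)
qed

lemma affine_combination2_in_class:
  assumes "y \<in> D" "z \<in> D"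
  shows "(\<lambda>\<omega>. a * y \<omega> + b * z \<omega> + c) \<in> D"
proof -
  have "(\<lambda>\<omega>. vec 2 (\<lambda>i. (if i = 0 then y else z) \<omega>)) \<in> rvecs D 2"
    using assms by (intro rvecs_of_components) auto
  from affine_combination_in_class[OF this, of "\<lambda>i. if i = 0 then a else b" c] show ?thesis
    by (simp add: numeral_2_eq_2)
qed

lemma add_in_class: "y \<in> D \<Longrightarrow> z \<in> D \<Longrightarrow> (\<lambda>\<omega>. y \<omega> + z \<omega>) \<in> D"
  using affine_combination2_in_class[of y z 1 1 0] by simp

lemma affine_in_class: "y \<in> D \<Longrightarrow> (\<lambda>\<omega>. a * y \<omega> + b) \<in> D"
  using affine_combination2_in_class[of y y a 0 b] by simp

lemma const_in_class: "(\<lambda>_. c) \<in> D"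
proof -
  obtain z where "z \<in> D" using rv_class by (auto simp: rv_class_def)
  then show ?thesis using affine_in_class[of z 0 c] by simp
qed

lemma measurable_coords:
  "x \<in> rvecs D l \<Longrightarrow> (\<lambda>\<omega>. coords l (x \<omega>)) \<in> M \<rightarrow>\<^sub>M borel_pow l"
  unfolding coords_def borel_pow_def
  by (intro measurable_restrict) (auto simp: rvecs_def intro: measurable_class)

text \<open>
  Independence is demanded of a vector that contains \<open>y\<close> as an additional last component: it
  has positive dimension even for \<open>n = 0\<close>, and independence from it restricts to \<open>x\<close>.
\<close>

lemma ex_independent_copy:
  assumes x: "x \<in> rvecs D n" and y: "y \<in> D"
  obtains y' where "y' \<in> D"
    "distr M (borel \<Otimes>\<^sub>M borel_pow n) (\<lambda>\<omega>. (y' \<omega>, coords n (x \<omega>))) =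
      distr M borel y \<Otimes>\<^sub>M vec_law M n x"
proof -
  define xp where "xp = (\<lambda>\<omega>. vec (Suc n) (\<lambda>i. (if i < n then \<lambda>\<omega>. x \<omega> $ i else y) \<omega>))"
  define yv where "yv = (\<lambda>\<omega>. vec 1 (\<lambda>i. y \<omega>))"
  have xp: "xp \<in> rvecs D (Suc n)"
    unfolding xp_def using x y by (intro rvecs_of_components) (auto simp: rvecs_component)
  have yv: "yv \<in> rvecs D 1"
    unfolding yv_def using y by (intro rvecs_of_components)
  have "\<exists>y'\<in>rvecs D 1. indep_var (borel_pow (Suc n)) (\<lambda>\<omega>. coords (Suc n) (xp \<omega>))
      (borel_pow 1) (\<lambda>\<omega>. coords 1 (y' \<omega>)) \<and> vec_law M 1 y' = vec_law M 1 yv"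
  proof -
    have "\<forall>k\<ge>1. \<forall>l\<ge>1. \<forall>x\<in>rvecs D k. \<forall>y\<in>rvecs D l. \<exists>y'\<in>rvecs D l.
        indep_var (borel_pow k) (\<lambda>\<omega>. coords k (x \<omega>)) (borel_pow l) (\<lambda>\<omega>. coords l (y' \<omega>)) \<and>
        vec_law M l y' = vec_law M l y"
      using rv_class unfolding rv_class_def by blast
    then show ?thesis using xp yv by simp
  qed
  then obtain yv' where yv': "yv' \<in> rvecs D 1" and
    ind: "indep_var (borel_pow (Suc n)) (\<lambda>\<omega>. coords (Suc n) (xp \<omega>))
      (borel_pow 1) (\<lambda>\<omega>. coords 1 (yv' \<omega>))" and law: "vec_law M 1 yv' = vec_law M 1 yv"
    by blast
  have m0: "(\<lambda>u. u 0) \<in> borel_pow 1 \<rightarrow>\<^sub>M borel"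
    unfolding borel_pow_def by (rule measurable_component_singleton) auto
  have mr: "(\<lambda>u. restrict u {..<n}) \<in> borel_pow (Suc n) \<rightarrow>\<^sub>M borel_pow n"
    unfolding borel_pow_def by (rule measurable_restrict_subset) auto
  have law0: "distr (vec_law M 1 yv) borel (\<lambda>u. u 0) = distr M borel y"
    unfolding vec_law_def
    by (subst distr_distr[OF m0 measurable_coords[OF yv]]) (simp add: o_def coords_def yv_def)
  show thesis
  proof
    show "(\<lambda>\<omega>. yv' \<omega> $ 0) \<in> D" using yv' by (rule rvecs_component) simp
    \<comment> \<open>push the joint law of the two vectors forward along the projections to \<open>y'\<close> and to \<open>x\<close>\<close>
    let ?L1 = "vec_law M 1 yv'" and ?L2 = "vec_law M (Suc n) xp"
    interpret L1: prob_space ?L1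
      unfolding vec_law_def using measurable_coords[OF yv'] by (rule prob_space_distr)
    interpret L2: prob_space ?L2
      unfolding vec_law_def using measurable_coords[OF xp] by (rule prob_space_distr)
    interpret pair_sigma_finite ?L1 ?L2 ..
    note mc = measurable_coords[OF yv'] measurable_coords[OF xp]
    have "distr M (borel_pow (Suc n) \<Otimes>\<^sub>M borel_pow 1)
        (\<lambda>\<omega>. (coords (Suc n) (xp \<omega>), coords 1 (yv' \<omega>))) = ?L2 \<Otimes>\<^sub>M ?L1"
      using ind unfolding indep_var_distribution_eq vec_law_def by simp
    then have "?L1 \<Otimes>\<^sub>M ?L2 = distr (distr M (borel_pow (Suc n) \<Otimes>\<^sub>M borel_pow 1)
        (\<lambda>\<omega>. (coords (Suc n) (xp \<omega>), coords 1 (yv' \<omega>)))) (?L1 \<Otimes>\<^sub>M ?L2) (\<lambda>(v, u). (u, v))"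
      using distr_pair_swap by simp
    also have "\<dots> = distr (distr M (borel_pow (Suc n) \<Otimes>\<^sub>M borel_pow 1)
        (\<lambda>\<omega>. (coords (Suc n) (xp \<omega>), coords 1 (yv' \<omega>)))) (borel_pow 1 \<Otimes>\<^sub>M borel_pow (Suc n)) (\<lambda>(v, u). (u, v))"
      by (intro distr_cong) (auto simp: vec_law_def intro!: sets_pair_measure_cong)
    also have "\<dots> = distr M (borel_pow 1 \<Otimes>\<^sub>M borel_pow (Suc n))
        (\<lambda>\<omega>. (coords 1 (yv' \<omega>), coords (Suc n) (xp \<omega>)))"
    proof (subst distr_distr)
      show "(\<lambda>\<omega>. (coords (Suc n) (xp \<omega>), coords 1 (yv' \<omega>)))
          \<in> M \<rightarrow>\<^sub>M borel_pow (Suc n) \<Otimes>\<^sub>M borel_pow 1"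
        using mc by (intro measurable_Pair)
      show "(\<lambda>(v, u). (u, v)) \<in> borel_pow (Suc n) \<Otimes>\<^sub>M borel_pow 1
          \<rightarrow>\<^sub>M borel_pow 1 \<Otimes>\<^sub>M borel_pow (Suc n)"
        by (rule measurable_pair_swap')
    qed (simp add: o_def)
    finally have "distr M (borel_pow 1 \<Otimes>\<^sub>M borel_pow (Suc n))
        (\<lambda>\<omega>. (coords 1 (yv' \<omega>), coords (Suc n) (xp \<omega>))) = ?L1 \<Otimes>\<^sub>M ?L2" by simp
    then have "distr (?L1 \<Otimes>\<^sub>M ?L2) (borel \<Otimes>\<^sub>M borel_pow n) (\<lambda>(u, v). (u 0, restrict v {..<n}))
      = distr M (borel \<Otimes>\<^sub>M borel_pow n)
          ((\<lambda>(u, v). (u 0, restrict v {..<n})) \<circ> (\<lambda>\<omega>. (coords 1 (yv' \<omega>), coords (Suc n) (xp \<omega>))))"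
    proof -
      have "(\<lambda>(u, v). (u 0, restrict v {..<n})) \<in>
          borel_pow 1 \<Otimes>\<^sub>M borel_pow (Suc n) \<rightarrow>\<^sub>M borel \<Otimes>\<^sub>M borel_pow n"
        using measurable_compose[OF measurable_fst m0] measurable_compose[OF measurable_snd mr]
        unfolding case_prod_beta' by (rule measurable_Pair)
      from distr_distr[OF this measurable_Pair[OF mc]] show ?thesis
        unfolding \<open>_ = ?L1 \<Otimes>\<^sub>M ?L2\<close> by simp
    qed
    also have "(\<lambda>(u, v). (u 0, restrict v {..<n})) \<circ> (\<lambda>\<omega>. (coords 1 (yv' \<omega>), coords (Suc n) (xp \<omega>)))
      = (\<lambda>\<omega>. (yv' \<omega> $ 0, coords n (x \<omega>)))"
      by (auto simp: fun_eq_iff coords_def xp_def)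
    finally have "distr M (borel \<Otimes>\<^sub>M borel_pow n) (\<lambda>\<omega>. (yv' \<omega> $ 0, coords n (x \<omega>)))
      = distr (?L1 \<Otimes>\<^sub>M ?L2) (borel \<Otimes>\<^sub>M borel_pow n) (\<lambda>(u, v). (u 0, restrict v {..<n}))"
      by (rule sym)
    also have "\<dots> = distr ?L1 borel (\<lambda>u. u 0) \<Otimes>\<^sub>M distr ?L2 (borel_pow n) (\<lambda>u. restrict u {..<n})"
    proof (rule pair_measure_distr[symmetric])
      show "(\<lambda>u. u 0) \<in> ?L1 \<rightarrow>\<^sub>M borel" using m0 by (simp add: vec_law_def)
      show mr': "(\<lambda>u. restrict u {..<n}) \<in> ?L2 \<rightarrow>\<^sub>M borel_pow n" using mr by (simp add: vec_law_def)
      show "sigma_finite_measure (distr ?L2 (borel_pow n) (\<lambda>u. restrict u {..<n}))"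
        using mr' by (intro prob_space_imp_sigma_finite L2.prob_space_distr)
    qed
    also have "distr ?L2 (borel_pow n) (\<lambda>u. restrict u {..<n}) = vec_law M n x"
    proof -
      have "(\<lambda>u. restrict u {..<n}) \<circ> (\<lambda>\<omega>. coords (Suc n) (xp \<omega>)) = (\<lambda>\<omega>. coords n (x \<omega>))"
        by (auto simp: fun_eq_iff coords_def xp_def)
      then show ?thesis
        unfolding vec_law_def using distr_distr[OF mr measurable_coords[OF xp]] by simp
    qed
    also have "distr ?L1 borel (\<lambda>u. u 0) = distr M borel y"
      using law0 law by simp
    finally show "distr M (borel \<Otimes>\<^sub>M borel_pow n) (\<lambda>\<omega>. (yv' \<omega> $ 0, coords n (x \<omega>))) =
      distr M borel y \<Otimes>\<^sub>M vec_law M n x" .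
  qed
qed

text \<open>
  Used both for identically distributed samples and for completing a scalar by standard normals.
\<close>

lemma ex_independent_copies:
  assumes Y: "\<And>i. Y i \<in> D"
  shows "\<exists>x\<in>rvecs D n. vec_law M n x = Pi\<^sub>M {..<n} (\<lambda>i. distr M borel (Y i))"
proof (induction n)
  case 0
  have "(\<lambda>_. vec 0 (\<lambda>_. 0)) \<in> rvecs D 0" by (auto simp: rvecs_def)
  moreover have "vec_law M 0 (\<lambda>_. vec 0 (\<lambda>_. 0)) = Pi\<^sub>M {..<0} (\<lambda>i. distr M borel (Y i))"
  proof -
    interpret product_sigma_finite "\<lambda>i. distr M borel (Y i)"
      using Y by (intro product_sigma_finite.intro prob_space_imp_sigma_finite prob_space_distr) (auto intro: measurable_class)
    show ?thesis
      by (rule PiM_eqI)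
        (auto simp: vec_law_def borel_pow_def coords_def emeasure_distr sets_PiM_empty emeasure_space_1
          intro!: sets_PiM_cong)
  qed
  ultimately show ?case by blast
next
  case (Suc n)
  then obtain x where x: "x \<in> rvecs D n"
    and lawx: "vec_law M n x = Pi\<^sub>M {..<n} (\<lambda>i. distr M borel (Y i))" by blast
  obtain y' where y': "y' \<in> D"
    and joint: "distr M (borel \<Otimes>\<^sub>M borel_pow n) (\<lambda>\<omega>. (y' \<omega>, coords n (x \<omega>))) =
      distr M borel (Y n) \<Otimes>\<^sub>M vec_law M n x"
    using ex_independent_copy[OF x Y] .
  define x' where "x' = (\<lambda>\<omega>. vec (Suc n) (\<lambda>i. (if i < n then \<lambda>\<omega>. x \<omega> $ i else y') \<omega>))"
  have x': "x' \<in> rvecs D (Suc n)"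
    unfolding x'_def using x y' by (intro rvecs_of_components) (auto simp: rvecs_component)
  let ?up = "\<lambda>(t, u). u(n := t)"
  have up: "?up \<in> borel \<Otimes>\<^sub>M borel_pow n \<rightarrow>\<^sub>M borel_pow (Suc n)"
    unfolding borel_pow_def lessThan_Suc by measurable
  have "coords (Suc n) (x' \<omega>) = ?up (y' \<omega>, coords n (x \<omega>))" for \<omega>
    by (auto simp: coords_def x'_def fun_eq_iff)
  then have "vec_law M (Suc n) x' = distr M (borel_pow (Suc n)) (?up \<circ> (\<lambda>\<omega>. (y' \<omega>, coords n (x \<omega>))))"
    by (simp add: vec_law_def o_def)
  also have "\<dots> = distr (distr M (borel \<Otimes>\<^sub>M borel_pow n) (\<lambda>\<omega>. (y' \<omega>, coords n (x \<omega>)))) (borel_pow (Suc n)) ?up"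
    using up measurable_coords[OF x] y' by (intro distr_distr[symmetric] measurable_Pair) (auto intro: measurable_class)
  also have "distr M (borel \<Otimes>\<^sub>M borel_pow n) (\<lambda>\<omega>. (y' \<omega>, coords n (x \<omega>)))
      = distr M borel (Y n) \<Otimes>\<^sub>M (Pi\<^sub>M {..<n} (\<lambda>i. distr M borel (Y i)))"
    by (simp add: joint lawx)
  also have "distr \<dots> (borel_pow (Suc n)) ?up
     = distr \<dots> (Pi\<^sub>M (insert n {..<n}) (\<lambda>i. distr M borel (Y i))) ?up"
    by (rule distr_cong) (auto simp: borel_pow_def lessThan_Suc intro!: sets_PiM_cong)
  also have "\<dots> = Pi\<^sub>M (insert n {..<n}) (\<lambda>i. distr M borel (Y i))"
    using Y by (intro distr_pair_PiM_eq_PiM prob_space_distr) (auto intro: measurable_class)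
  finally show ?case using x' by (auto simp: lessThan_Suc)
qed

lemma law_component:
  assumes x: "x \<in> rvecs D n" and i: "i < n" and law: "vec_law M n x = Pi\<^sub>M {..<n} N"
    and N: "\<And>i. real_distribution (N i)"
  shows "distr M borel (\<lambda>\<omega>. x \<omega> $ i) = N i"
proof -
  have m: "(\<lambda>u. u i) \<in> borel_pow n \<rightarrow>\<^sub>M borel"
    unfolding borel_pow_def using i by (intro measurable_component_singleton) auto
  have "distr M borel (\<lambda>\<omega>. x \<omega> $ i) = distr (vec_law M n x) borel (\<lambda>u. u i)"
    unfolding vec_law_def distr_distr[OF m measurable_coords[OF x]]
    using i by (simp add: o_def coords_def)
  also have "\<dots> = distr (Pi\<^sub>M {..<n} N) (N i) (\<lambda>u. u i)"
    unfolding law using N[of i] by (intro distr_cong) (auto simp: real_distribution.events_eq_borel)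
  also have "\<dots> = N i"
    using N i by (intro distr_PiM_component) (auto simp: real_distribution_def)
  finally show ?thesis .
qed

end

section \<open>Equivariant families and their quadratic form\<close>

locale equivariant_family = square_integrable_class M D
  for M :: "'a measure" and D :: "('a \<Rightarrow> real) set" +
  fixes F :: "nat \<Rightarrow> ('a \<Rightarrow> real vec) \<Rightarrow> real mat"
  assumes psd: "k \<ge> 1 \<Longrightarrow> x \<in> rvecs D k \<Longrightarrow> F k x \<in> sym_psd k"
    and equivariant: "k \<ge> 1 \<Longrightarrow> l \<ge> 1 \<Longrightarrow> x \<in> rvecs D l \<Longrightarrow> A \<in> carrier_mat k l \<Longrightarrow> b \<in> carrier_vec k
      \<Longrightarrow> F k (\<lambda>\<omega>. A *\<^sub>v x \<omega> + b) = A * F l x * transpose_mat A"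
begin

text \<open>
  The scalar member of the family. It is quadratic and ignores translations, so it plays the
  role of a squared measure of scale.
\<close>

definition scale_sq :: "('a \<Rightarrow> real) \<Rightarrow> real" where
  "scale_sq y = F 1 (\<lambda>\<omega>. vec 1 (\<lambda>_. y \<omega>)) $$ (0, 0)"

lemma F_carrier: "k \<ge> 1 \<Longrightarrow> x \<in> rvecs D k \<Longrightarrow> F k x \<in> carrier_mat k k"
  using psd by (auto simp: sym_psd_def)

lemma F_symmetric:
  assumes "k \<ge> 1" "x \<in> rvecs D k" "i < k" "j < k"
  shows "F k x $$ (i, j) = F k x $$ (j, i)"
proof -
  have "transpose_mat (F k x) = F k x" using psd[OF assms(1,2)] by (auto simp: sym_psd_def)
  then have "F k x $$ (i, j) = transpose_mat (F k x) $$ (i, j)" by simp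
  also have "\<dots> = F k x $$ (j, i)"
    using F_carrier[OF assms(1,2)] assms(3,4) by simp
  finally show ?thesis .
qed

text \<open>
  Equivariance under the \<open>1 \<times> l\<close> matrix with the entries \<open>a\<close>.
\<close>

lemma scale_sq_affine_combination:
  assumes l: "l \<ge> 1" and x: "x \<in> rvecs D l"
  shows "scale_sq (\<lambda>\<omega>. (\<Sum>i<l. a i * x \<omega> $ i) + b) = (\<Sum>i<l. \<Sum>j<l. a i * a j * F l x $$ (i, j))"
proof -
  have xc: "x \<omega> \<in> carrier_vec l" for \<omega> using x by (auto simp: rvecs_def)
  have Fc: "F l x \<in> carrier_mat l l" by (rule F_carrier[OF l x])
  let ?A = "mat 1 l (\<lambda>(_, i). a i)" and ?b = "vec 1 (\<lambda>_. b)"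
  have "(\<lambda>\<omega>. vec 1 (\<lambda>_. (\<Sum>i<l. a i * x \<omega> $ i) + b)) = (\<lambda>\<omega>. ?A *\<^sub>v x \<omega> + ?b)"
    using xc by (auto intro!: eq_vecI simp: scalar_prod_def carrier_vecD[OF xc] lessThan_atLeast0)
  then have "scale_sq (\<lambda>\<omega>. (\<Sum>i<l. a i * x \<omega> $ i) + b) = (?A * F l x * transpose_mat ?A) $$ (0, 0)"
    unfolding scale_sq_def using equivariant[OF _ l x, of 1 ?A ?b] by simp
  also have "\<dots> = (\<Sum>j<l. (\<Sum>i<l. a i * F l x $$ (i, j)) * a j)"
    using Fc by (simp add: scalar_prod_def lessThan_atLeast0)
  also have "\<dots> = (\<Sum>j<l. \<Sum>i<l. a i * a j * F l x $$ (i, j))"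
    by (simp add: sum_distrib_left mult_ac)
  also have "\<dots> = (\<Sum>i<l. \<Sum>j<l. a i * a j * F l x $$ (i, j))" by (rule sum.swap)
  finally show ?thesis .
qed

lemma scale_sq_affine:
  assumes y: "y \<in> D"
  shows "scale_sq (\<lambda>\<omega>. a * y \<omega> + b) = a\<^sup>2 * scale_sq y"
proof -
  have "(\<lambda>\<omega>. vec 1 (\<lambda>i. y \<omega>)) \<in> rvecs D 1" using y by (intro rvecs_of_components)
  from scale_sq_affine_combination[OF _ this, of "\<lambda>_. a" b] show ?thesis
    by (simp add: scale_sq_def power2_eq_square)
qed

lemma scale_sq_component_add:
  assumes l: "l \<ge> 1" and x: "x \<in> rvecs D l" and ij: "i < l" "j < l"
  shows "scale_sq (\<lambda>\<omega>. x \<omega> $ i + x \<omega> $ j) = F l x $$ (i, i) + F l x $$ (j, j) + 2 * F l x $$ (i, j)"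
proof -
  \<comment> \<open>the coefficient vector \<open>e\<^sub>i + e\<^sub>j\<close>, which is \<open>2 e\<^sub>i\<close> if \<open>i = j\<close>\<close>
  let ?a = "\<lambda>k. of_bool (k = i) + of_bool (k = j) :: real"
  have "scale_sq (\<lambda>\<omega>. (\<Sum>k<l. ?a k * x \<omega> $ k) + 0) = (\<Sum>k<l. \<Sum>m<l. ?a k * ?a m * F l x $$ (k, m))"
    by (rule scale_sq_affine_combination[OF l x])
  moreover have "(\<Sum>k<l. ?a k * h k) = h i + h j" for h :: "nat \<Rightarrow> real"
  proof -
    have "of_bool (k = m) * h k = (if k = m then h m else 0)" for k m by simp
    then show ?thesis using ij by (simp only: distrib_right sum.distrib) simp
  qed
  ultimately show ?thesis
    using F_symmetric[OF l x ij] by (simp add: mult.assoc sum_distrib_left[symmetric])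
qed

lemma F_diagonal:
  assumes l: "l \<ge> 1" and x: "x \<in> rvecs D l" and i: "i < l"
  shows "F l x $$ (i, i) = scale_sq (\<lambda>\<omega>. x \<omega> $ i)"
proof -
  have "4 * F l x $$ (i, i) = scale_sq (\<lambda>\<omega>. 2 * x \<omega> $ i + 0)"
    using scale_sq_component_add[OF l x i i] by simp
  also have "\<dots> = 4 * scale_sq (\<lambda>\<omega>. x \<omega> $ i)"
    using scale_sq_affine[OF rvecs_component[OF x i], of 2 0] by simp
  finally show ?thesis by simp
qed

lemma F_polarization:
  assumes l: "l \<ge> 1" and x: "x \<in> rvecs D l" and ij: "i < l" "j < l"
  shows "F l x $$ (i, j) = (scale_sq (\<lambda>\<omega>. x \<omega> $ i + x \<omega> $ j)
    - scale_sq (\<lambda>\<omega>. x \<omega> $ i) - scale_sq (\<lambda>\<omega>. x \<omega> $ j)) / 2"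
  using scale_sq_component_add[OF assms] F_diagonal[OF l x] ij by simp

text \<open>
  Self-containedness is assumed in dimension \<open>p\<close> only. It reaches scalars through the embedding
  \<open>y \<mapsto> (y, 0, \<dots>, 0)\<close>, whose first diagonal entry is \<open>scale_sq y\<close>.
\<close>

lemma scale_sq_law_invariant:
  assumes p: "p \<ge> 1" and sc: "self_contained M D p (F p)"
    and y: "y \<in> D" "y' \<in> D" "distr M borel y = distr M borel y'"
  shows "scale_sq y = scale_sq y'"
proof -
  let ?x = "\<lambda>y \<omega>. vec p (\<lambda>i. if i = 0 then y \<omega> else 0)"
  have x: "?x z \<in> rvecs D p" if "z \<in> D" for z
  proof -
    have "(\<lambda>\<omega>. if i = 0 then z \<omega> else 0) \<in> D" for i :: nat
      using that const_in_class[of 0] by (cases "i = 0") auto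
    then show ?thesis by (rule rvecs_of_components)
  qed
  have diag: "F p (?x z) $$ (0, 0) = scale_sq z" if "z \<in> D" for z
    using F_diagonal[OF p x[OF that], of 0] p by simp
  have m: "(\<lambda>t. \<lambda>i\<in>{..<p}. if i = 0 then t else (0 :: real)) \<in> borel \<rightarrow>\<^sub>M borel_pow p"
    unfolding borel_pow_def by (intro measurable_restrict) auto
  have "vec_law M p (?x z) = distr (distr M borel z) (borel_pow p) (\<lambda>t. \<lambda>i\<in>{..<p}. if i = 0 then t else 0)"
    if "z \<in> D" for z
    unfolding vec_law_def distr_distr[OF m measurable_class[OF that]]
    by (rule arg_cong[where f = "distr M (borel_pow p)"]) (auto simp: coords_def fun_eq_iff)
  then have "vec_law M p (?x y) = vec_law M p (?x y')" using y by simp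
  then have "F p (?x y) = F p (?x y')"
    using sc[unfolded self_contained_def, rule_format, OF x[OF y(1)] x[OF y(2)]] by simp
  then show ?thesis using diag[OF y(1)] diag[OF y(2)] by simp
qed

end

section \<open>Identification with the variance and the covariance\<close>

locale law_invariant_family = equivariant_family M D F
  for M :: "'a measure" and D F +
  fixes p :: nat
  assumes p: "p \<ge> 1"
    and normal_continuous: "normal_continuous M D p (F p)"
    and self_contained: "self_contained M D p (F p)"
begin

lemma scale_sq_eqI: "y \<in> D \<Longrightarrow> y' \<in> D \<Longrightarrow> distr M borel y = distr M borel y' \<Longrightarrow> scale_sq y = scale_sq y'"
  using scale_sq_law_invariant[OF p self_contained] .

text \<open>
  Normal continuity, too, is available in dimension \<open>p\<close> only, and the limit law there must be
  non-degenerate. This is why the remaining coordinates are filled with independent standard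
  normals and not with zeros.
\<close>

lemma scale_sq_tendsto_1:
  assumes T: "\<And>n. T n \<in> D" and mean: "\<And>n. expectation (T n) = 0"
    and conv: "weak_conv_m (\<lambda>n. distr M borel (T n)) std_normal_distribution"
  shows "(\<lambda>n. scale_sq (T n)) \<longlonglongrightarrow> 1"
proof -
  obtain z where z: "z \<in> D" "distributed M lborel z std_normal_density"
    using rv_class by (auto simp: rv_class_def)
  have "distr M borel z = distr M lborel z" by (rule distr_cong) auto
  also have "\<dots> = std_normal_distribution" using z(2) by (rule distributed_distr_eq_density)
  finally have lawz: "distr M borel z = std_normal_distribution" .
  have "\<forall>n. \<exists>x\<in>rvecs D p. vec_law M p x = Pi\<^sub>M {..<p} (\<lambda>i. distr M borel ((if i = 0 then T n else z)))"
    using ex_independent_copies[of "\<lambda>i. if i = 0 then T _ else z"] T z by auto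
  then obtain x where x: "\<And>n. x n \<in> rvecs D p"
    and lawx: "\<And>n. vec_law M p (x n) = Pi\<^sub>M {..<p} (\<lambda>i. distr M borel ((if i = 0 then T n else z)))"
    by metis
  have comp: "distr M borel (\<lambda>\<omega>. x n \<omega> $ i) = distr M borel (if i = 0 then T n else z)" if "i < p" for n i
    using x that lawx by (rule law_component) (auto intro: real_distribution_law T z)
  have exp_law: "expectation y = (\<integral>t. t \<partial>distr M borel y)" if "y \<in> D" for y
    using measurable_class[OF that] by (simp add: integral_distr)
  have mean0: "expectation (\<lambda>\<omega>. x n \<omega> $ i) = 0" if "i < p" for n i
  proof (cases "i = 0")
    case True
    then show ?thesis
      using comp[OF that, of n] exp_law[OF rvecs_component[OF x that]] exp_law[OF T] mean by simp
  next
    case False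
    then have "expectation (\<lambda>\<omega>. x n \<omega> $ i) = (\<integral>t. t \<partial>std_normal_distribution)"
      using comp[OF that, of n] exp_law[OF rvecs_component[OF x that]] lawz by simp
    also have "\<dots> = 0"
      using integral_std_normal_distribution_moment_odd[of 1] by simp
    finally show ?thesis .
  qed
  have "conv_in_law p (\<lambda>n. Pi\<^sub>M {..<p} (\<lambda>i. if i = 0 then distr M borel (T n) else std_normal_distribution))
    (Pi\<^sub>M {..<p} (\<lambda>i. if i = 0 then std_normal_distribution else std_normal_distribution))"
    using T by (intro conv_in_law_replace_first_factor p real_distribution_law std_normal_real_distribution conv)
  moreover have "Pi\<^sub>M {..<p} (\<lambda>i. if i = 0 then distr M borel (T n) else std_normal_distribution) = vec_law M p (x n)" for n
    unfolding lawx by (intro PiM_cong) (auto simp: lawz)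
  ultimately have "conv_in_law p (\<lambda>n. vec_law M p (x n)) (normal_law p (1\<^sub>m p))"
    by (simp add: normal_law_one)
  then have lim: "(\<lambda>n. frobenius_norm (F p (x n) - 1\<^sub>m p)) \<longlonglongrightarrow> 0"
    using normal_continuous[unfolded normal_continuous_def, rule_format, OF one_mat_sym_pd, of x] x mean0
    by simp
  have "\<bar>scale_sq (T n) - 1\<bar> \<le> frobenius_norm (F p (x n) - 1\<^sub>m p)" for n
  proof -
    have "scale_sq (T n) = scale_sq (\<lambda>\<omega>. x n \<omega> $ 0)"
      using comp[of 0 n] p by (intro scale_sq_eqI T rvecs_component[OF x]) auto
    then have "scale_sq (T n) - 1 = (F p (x n) - 1\<^sub>m p) $$ (0, 0)"
      using F_diagonal[OF p x, of 0 n] F_carrier[OF p x[of n]] p by simp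
    then show ?thesis
      using abs_entry_le_frobenius_norm[of 0 "F p (x n) - 1\<^sub>m p" 0] F_carrier[OF p x[of n]] p by simp
  qed
  then have "(\<lambda>n. scale_sq (T n) - 1) \<longlonglongrightarrow> 0"
    by (intro Lim_null_comparison[OF _ lim]) auto
  then show ?thesis by (simp add: LIM_zero_iff)
qed

text \<open>
  The heart of the argument: the sequence \<open>c + n * d\<close> of the values at normalized sums converges
  to 1, which forces \<open>d = 0\<close> and \<open>c = 1\<close>.
\<close>

lemma scale_sq_standardized:
  assumes y: "y \<in> D" and mean: "expectation y = 0" and var: "expectation (\<lambda>\<omega>. (y \<omega>)\<^sup>2) = 1"
  shows "scale_sq y = 1"
proof -
  let ?\<mu> = "distr M borel y"
  have rd: "real_distribution ?\<mu>" using y by (rule real_distribution_law)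
  have ym[measurable]: "y \<in> borel_measurable M" using y by (rule measurable_class)
  have "\<forall>n. \<exists>x\<in>rvecs D n. vec_law M n x = Pi\<^sub>M {..<n} (\<lambda>_. ?\<mu>)"
    using ex_independent_copies[of "\<lambda>_. y"] y by auto
  then obtain x where x: "\<And>n. x n \<in> rvecs D n" and lawx: "\<And>n. vec_law M n (x n) = Pi\<^sub>M {..<n} (\<lambda>_. ?\<mu>)"
    by metis
  have comp: "distr M borel (\<lambda>\<omega>. x n \<omega> $ i) = ?\<mu>" if "i < n" for n i
    using x that lawx by (rule law_component) (rule rd)
  define c where "c = scale_sq y"
  define d where "d = F 2 (x 2) $$ (0, 1)"
  have diag: "F n (x n) $$ (i, i) = c" if "i < n" for n i
    using F_diagonal[OF _ x that] that comp[OF that] y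
    by (auto simp: c_def intro!: scale_sq_eqI rvecs_component[OF x])
  have pair_law: "distr M borel (\<lambda>\<omega>. x n \<omega> $ i + x n \<omega> $ j)
      = distr (Pi\<^sub>M {..<2} (\<lambda>_. ?\<mu>)) borel (\<lambda>u. u 0 + u (1 :: nat))"
    if ij: "i < n" "j < n" "i \<noteq> j" for n i j
  proof -
    have "distr (Pi\<^sub>M {..<2} (\<lambda>_. ?\<mu>)) borel (\<lambda>u. u 0 + u (1 :: nat))
      = distr (Pi\<^sub>M {..<n} (\<lambda>_. ?\<mu>)) borel (\<lambda>u. u i + u j)"
      using distr_iid_pair_sum[OF rd ij] by simp
    also have "\<dots> = distr (vec_law M n (x n)) borel (\<lambda>u. u i + u j)" by (simp add: lawx)
    also have "\<dots> = distr M borel (\<lambda>\<omega>. x n \<omega> $ i + x n \<omega> $ j)"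
      unfolding vec_law_def
    proof (subst distr_distr[OF _ measurable_coords[OF x]])
      show "(\<lambda>u. u i + u j) \<in> borel_measurable (borel_pow n)"
        unfolding borel_pow_def using ij by (intro borel_measurable_add measurable_component_singleton) auto
    qed (use ij in \<open>simp add: o_def coords_def\<close>)
    finally show ?thesis by simp
  qed
  have offdiag: "F n (x n) $$ (i, j) = d" if ij: "i < n" "j < n" "i \<noteq> j" for n i j
  proof -
    have "scale_sq (\<lambda>\<omega>. x n \<omega> $ i + x n \<omega> $ j) = scale_sq (\<lambda>\<omega>. x 2 \<omega> $ 0 + x 2 \<omega> $ 1)"
      using ij pair_law[OF ij] pair_law[of 0 2 1]
      by (intro scale_sq_eqI add_in_class rvecs_component[OF x]) auto
    then show ?thesis
      using scale_sq_component_add[OF _ x[of n] ij(1,2)] scale_sq_component_add[OF _ x[of 2], of 0 1] ij diag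
      by (simp add: d_def)
  qed
  \<comment> \<open>sums over \<open>Suc n\<close> copies, since vectors of dimension 0 are not covered by equivariance\<close>
  define T where "T n = (\<lambda>\<omega>. (\<Sum>i<Suc n. x (Suc n) \<omega> $ i) / sqrt (real (Suc n)))" for n
  have T_eq: "T n = (\<lambda>\<omega>. (\<Sum>i<Suc n. 1 / sqrt (real (Suc n)) * x (Suc n) \<omega> $ i) + 0)" for n
    unfolding T_def by (simp only: sum_divide_distrib) simp
  have TD: "T n \<in> D" for n
    unfolding T_eq by (rule affine_combination_in_class[OF x]) simp
  have scT: "scale_sq (T n) = c + real n * d" for n
  proof -
    have "scale_sq (T n) = (\<Sum>i<Suc n. \<Sum>j<Suc n. 1 / sqrt (real (Suc n)) * (1 / sqrt (real (Suc n))) * F (Suc n) (x (Suc n)) $$ (i, j))"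
      unfolding T_eq by (rule scale_sq_affine_combination[OF _ x]) simp
    also have "\<dots> = (\<Sum>i<Suc n. \<Sum>j<Suc n. (d + of_bool (i = j) * (c - d)) / real (Suc n))"
      by (intro sum.cong refl) (auto simp: diag offdiag)
    also have "\<dots> = (\<Sum>i<Suc n. (\<Sum>j<Suc n. d + of_bool (i = j) * (c - d))) / real (Suc n)"
      by (simp only: sum_divide_distrib)
    also have "(\<Sum>i<Suc n. (\<Sum>j<Suc n. d + of_bool (i = j) * (c - d))) = (\<Sum>i<Suc n. real (Suc n) * d + (c - d))"
    proof (intro sum.cong refl)
      fix i assume "i \<in> {..<Suc n}"
      then have "(\<Sum>j<Suc n. of_bool (i = j) * (c - d)) = (\<Sum>j<Suc n. if i = j then c - d else 0)"
        by (intro sum.cong) auto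
      also have "\<dots> = c - d" using \<open>i \<in> {..<Suc n}\<close> by (subst sum.delta') auto
      finally show "(\<Sum>j<Suc n. d + of_bool (i = j) * (c - d)) = real (Suc n) * d + (c - d)"
        by (simp only: sum.distrib sum_constant card_lessThan)
    qed
    also have "\<dots> / real (Suc n) = c + real n * d"
      by (simp only: sum_constant card_lessThan) (simp add: field_simps)
    finally show ?thesis .
  qed
  have Tmean: "expectation (T n) = 0" for n
  proof -
    have "expectation (\<lambda>\<omega>. x (Suc n) \<omega> $ i) = 0" if "i < Suc n" for i
    proof -
      have "expectation (\<lambda>\<omega>. x (Suc n) \<omega> $ i) = (\<integral>t. t \<partial>?\<mu>)"
        unfolding comp[OF that, symmetric]
        using measurable_class[OF rvecs_component[OF x that]] by (simp add: integral_distr)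
      also have "\<dots> = 0" using mean by (simp add: integral_distr)
      finally show ?thesis .
    qed
    moreover have "integrable M (\<lambda>\<omega>. x (Suc n) \<omega> $ i)" if "i < Suc n" for i
      using integrable_class[OF rvecs_component[OF x that]] .
    ultimately show ?thesis
      unfolding T_def by (simp del: sum.lessThan_Suc)
  qed
  have "weak_conv_m (\<lambda>n. distr (Pi\<^sub>M {..<n} (\<lambda>_. ?\<mu>)) borel (\<lambda>u. (\<Sum>i<n. u i) / sqrt (real n)))
    std_normal_distribution"
  proof (rule iid_sums_weak_conv[OF rd])
    show "integrable ?\<mu> (\<lambda>t. t\<^sup>2)"
      using square_integrable_class[OF y] by (simp add: integrable_distr_eq)
  qed (use mean var in \<open>simp_all add: integral_distr\<close>)
  then have clt: "weak_conv_m (\<lambda>n. distr (Pi\<^sub>M {..<Suc n} (\<lambda>_. ?\<mu>)) borel (\<lambda>u. (\<Sum>i<Suc n. u i) / sqrt (real (Suc n))))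
    std_normal_distribution"
    unfolding weak_conv_m_def weak_conv_def 
  proof (intro allI impI)
    fix t assume "\<forall>x. isCont (cdf std_normal_distribution) x \<longrightarrow>
      (\<lambda>n. cdf (distr (Pi\<^sub>M {..<n} (\<lambda>_. ?\<mu>)) borel (\<lambda>u. (\<Sum>i<n. u i) / sqrt (real n))) x)
        \<longlonglongrightarrow> cdf std_normal_distribution x" "isCont (cdf std_normal_distribution) t"
    then have "(\<lambda>n. cdf (distr (Pi\<^sub>M {..<n} (\<lambda>_. ?\<mu>)) borel (\<lambda>u. (\<Sum>i<n. u i) / sqrt (real n))) t)
        \<longlonglongrightarrow> cdf std_normal_distribution t" by (elim allE[of _ t] impE)
    from LIMSEQ_Suc[OF this]
    show "(\<lambda>n. cdf (distr (Pi\<^sub>M {..<Suc n} (\<lambda>_. ?\<mu>)) borel (\<lambda>u. (\<Sum>i<Suc n. u i) / sqrt (real (Suc n)))) t)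
        \<longlonglongrightarrow> cdf std_normal_distribution t" .
  qed
  have lawT: "distr (Pi\<^sub>M {..<Suc n} (\<lambda>_. ?\<mu>)) borel (\<lambda>u. (\<Sum>i<Suc n. u i) / sqrt (real (Suc n)))
    = distr M borel (T n)" for n
  proof -
    have m: "(\<lambda>u. (\<Sum>i<Suc n. u i) / sqrt (real (Suc n))) \<in> borel_measurable (borel_pow (Suc n))"
      unfolding borel_pow_def
      by (intro borel_measurable_divide borel_measurable_sum measurable_component_singleton borel_measurable_const) auto
    show ?thesis
      unfolding lawx[symmetric] unfolding vec_law_def distr_distr[OF m measurable_coords[OF x]]
      by (rule arg_cong[where f = "distr M borel"]) (auto simp: T_def o_def coords_def fun_eq_iff)
  qed
  from scale_sq_tendsto_1[OF TD Tmean clt[unfolded lawT]] have lim: "(\<lambda>n. c + real n * d) \<longlonglongrightarrow> 1"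
    by (simp add: scT)
  have "(\<lambda>n. (c + real (Suc n) * d) - (c + real n * d)) \<longlonglongrightarrow> 1 - 1"
    by (intro tendsto_diff lim LIMSEQ_Suc[OF lim])
  then have "d = 0" by (simp add: algebra_simps LIMSEQ_const_iff)
  with lim show ?thesis by (simp add: LIMSEQ_const_iff c_def)
qed

text \<open>
  Standardization reduces to centred variables of variance 1. A variable of variance 0 cannot be
  standardized; it has the law of a constant, that is, of its own image under \<open>t \<mapsto> 0 * t + m\<close>.
\<close>

lemma scale_sq_eq_variance:
  assumes y: "y \<in> D"
  shows "scale_sq y = variance y"
proof -
  define m where "m = expectation y"
  have ym: "y \<in> borel_measurable M" using y by (rule measurable_class)
  have yi: "integrable M y" by (rule integrable_class[OF y])
  have cD: "(\<lambda>\<omega>. 1 * y \<omega> + (- m)) \<in> D" by (rule affine_in_class[OF y])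
  have v2: "integrable M (\<lambda>\<omega>. (y \<omega> - m)\<^sup>2)" using square_integrable_class[OF cD] by simp
  have v: "variance y = expectation (\<lambda>\<omega>. (y \<omega> - m)\<^sup>2)" by (simp add: m_def)
  show ?thesis
  proof (cases "variance y = 0")
    case True
    then have "AE \<omega> in M. (y \<omega> - m)\<^sup>2 = 0"
      using v2 v by (subst integral_nonneg_eq_0_iff_AE[symmetric]) auto
    then have ae: "AE \<omega> in M. y \<omega> = m" by simp
    have "distr M borel y = distr M borel (\<lambda>\<omega>. 0 * y \<omega> + m)"
      using ae ym by (intro distr_cong_AE) auto
    then have "scale_sq y = scale_sq (\<lambda>\<omega>. 0 * y \<omega> + m)"
      by (intro scale_sq_eqI y affine_in_class)
    then show ?thesis using True scale_sq_affine[OF y, of 0 m] by simp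
  next
    case False
    define s where "s = sqrt (variance y)"
    have vpos: "variance y > 0" using False variance_positive[of y] by (simp add: less_le)
    then have s: "s > 0" "s\<^sup>2 = variance y" by (auto simp: s_def)
    let ?w = "\<lambda>\<omega>. (1 / s) * y \<omega> + (- m / s)"
    have weq: "?w \<omega> = (y \<omega> - m) / s" for \<omega> by (simp add: diff_divide_distrib)
    have wD: "?w \<in> D" by (rule affine_in_class[OF y])
    have "scale_sq ?w = 1"
    proof (rule scale_sq_standardized[OF wD])
      show "expectation ?w = 0" using yi by (simp add: m_def prob_space)
      show "expectation (\<lambda>\<omega>. (?w \<omega>)\<^sup>2) = 1"
        unfolding weq using s False v by (simp add: power_divide)
    qed
    then have "(1 / s)\<^sup>2 * scale_sq y = 1" using scale_sq_affine[OF y, of "1 / s" "- m / s"] by simp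
    then show ?thesis using s by (simp add: power_divide field_simps)
  qed
qed

lemma F_eq_covariance:
  assumes x: "x \<in> rvecs D p"
  shows "F p x = cov_mat M p x"
proof (rule eq_matI)
  show "dim_row (F p x) = dim_row (cov_mat M p x)" "dim_col (F p x) = dim_col (cov_mat M p x)"
    using F_carrier[OF p x] by (auto simp: cov_mat_def)
  fix i j assume "i < dim_row (cov_mat M p x)" "j < dim_col (cov_mat M p x)"
  then have ij: "i < p" "j < p" by (auto simp: cov_mat_def)
  let ?X = "\<lambda>i \<omega>. x \<omega> $ i"
  let ?C = "\<lambda>i \<omega>. x \<omega> $ i - expectation (?X i)"
  have XD: "?X i \<in> D" "?X j \<in> D" using rvecs_component[OF x] ij by auto
  have XI: "integrable M (?X i)" "integrable M (?X j)" using XD by (auto intro: integrable_class)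
  have CD: "?C i \<in> D" "?C j \<in> D"
    using affine_in_class[OF XD(1), of 1 "- expectation (?X i)"] affine_in_class[OF XD(2), of 1 "- expectation (?X j)"]
    by auto
  note sq = square_integrable_class[OF CD(1)] square_integrable_class[OF CD(2)]
    square_integrable_class[OF add_in_class[OF CD]]
  have "variance (\<lambda>\<omega>. ?X i \<omega> + ?X j \<omega>) = expectation (\<lambda>\<omega>. (?C i \<omega> + ?C j \<omega>)\<^sup>2)"
    using XI by (intro Bochner_Integration.integral_cong refl) (simp add: algebra_simps)
  moreover have "(\<lambda>\<omega>. ?C i \<omega> * ?C j \<omega>) = (\<lambda>\<omega>. ((?C i \<omega> + ?C j \<omega>)\<^sup>2 - (?C i \<omega>)\<^sup>2 - (?C j \<omega>)\<^sup>2) / 2)"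
    by (auto simp: power2_eq_square algebra_simps)
  then have "expectation (\<lambda>\<omega>. ?C i \<omega> * ?C j \<omega>) = (expectation (\<lambda>\<omega>. (?C i \<omega> + ?C j \<omega>)\<^sup>2)
    - expectation (\<lambda>\<omega>. (?C i \<omega>)\<^sup>2) - expectation (\<lambda>\<omega>. (?C j \<omega>)\<^sup>2)) / 2"
    using sq by simp
  ultimately have "expectation (\<lambda>\<omega>. ?C i \<omega> * ?C j \<omega>) =
    (variance (\<lambda>\<omega>. ?X i \<omega> + ?X j \<omega>) - variance (?X i) - variance (?X j)) / 2" by simp
  also have "\<dots> = F p x $$ (i, j)"
    using F_polarization[OF p x ij] scale_sq_eq_variance[OF XD(1)] scale_sq_eq_variance[OF XD(2)]
      scale_sq_eq_variance[OF add_in_class[OF XD]] by simp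
  finally show "F p x $$ (i, j) = cov_mat M p x $$ (i, j)"
    using ij by (simp add: cov_mat_def)
qed

end

theorem proposition2:
  fixes M :: "'a measure" and D :: "('a \<Rightarrow> real) set"
    and p :: nat and S :: "('a \<Rightarrow> real vec) \<Rightarrow> real mat"
  assumes "rv_class M D" and "p \<ge> 1"
    and "scatter_functional M D p S"
    and "normal_continuous M D p S"
    and "self_contained M D p S"
    and "full_affine_equivariant D p S"
  shows "\<forall>x\<in>rvecs D p. S x = cov_mat M p x"
proof -
  obtain F where F: "\<forall>k\<ge>1. \<forall>x\<in>rvecs D k. F k x \<in> sym_psd k" "\<forall>x\<in>rvecs D p. S x = F p x"
    "\<forall>k\<ge>1. \<forall>l\<ge>1. \<forall>x\<in>rvecs D l. \<forall>A\<in>carrier_mat k l. \<forall>b\<in>carrier_vec k.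
           F k (\<lambda>\<omega>. A *\<^sub>v x \<omega> + b) = A * F l x * transpose_mat A"
    using assms(6) unfolding full_affine_equivariant_def by blast
  have S: "S x = F p x" if "x \<in> rvecs D p" for x using F(2) that by blast
  interpret prob_space M using assms(1) by (simp add: rv_class_def)
  interpret law_invariant_family M D F p
  proof unfold_locales
    show "normal_continuous M D p (F p)"
      unfolding normal_continuous_def
    proof (intro ballI allI impI)
      fix \<Sigma> x
      assume \<Sigma>: "\<Sigma> \<in> sym_pd p" and x: "(\<forall>n. x n \<in> rvecs D p) \<and> (\<forall>n. \<forall>i<p. expectation (\<lambda>\<omega>. x n \<omega> $ i) = 0) \<and>
        conv_in_law p (\<lambda>n. vec_law M p (x n)) (normal_law p \<Sigma>)"
      have "S (x n) = F p (x n)" for n using x by (intro S) blast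
      then show "(\<lambda>n. frobenius_norm (F p (x n) - \<Sigma>)) \<longlonglongrightarrow> 0"
        using assms(4)[unfolded normal_continuous_def, rule_format, OF \<Sigma> x] by simp
    qed
    show "self_contained M D p (F p)"
      unfolding self_contained_def
    proof (intro ballI impI)
      fix x1 x2 assume x: "x1 \<in> rvecs D p" "x2 \<in> rvecs D p" and law: "vec_law M p x1 = vec_law M p x2"
      have "S x1 = S x2" using assms(5)[unfolded self_contained_def, rule_format, OF x law] .
      then show "F p x1 = F p x2" unfolding S[OF x(1)] S[OF x(2)] .
    qed
  next
    fix k x assume "k \<ge> 1" "x \<in> rvecs D k"
    then show "F k x \<in> sym_psd k" using F(1) by blast
  next
    fix k l :: nat and x and A :: "real mat" and b :: "real vec"
    assume "k \<ge> 1" "l \<ge> 1" "x \<in> rvecs D l" "A \<in> carrier_mat k l" "b \<in> carrier_vec k"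
    then show "F k (\<lambda>\<omega>. A *\<^sub>v x \<omega> + b) = A * F l x * transpose_mat A"
      using F(3)[rule_format] by blast
  qed (use assms(1,2) in auto)
  show ?thesis by (simp add: S F_eq_covariance)
qed

end
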